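(* Let $\mathbf{P}\subset\mathbb{C}$ be nonempty and compact. Let $(A,B) \in C_{n,n}(\mathbf{P}) \times C_{n,m}(\mathbf{P})$ be pointwise reachable and suppose that the Hermite indices are constant. Then there are $K \in C_{m,n}(\mathbf{P})$ and $v \in \mathbb{C}^m$ such that the single-input pair $(A+B K, Bv) \in C_{n,n}(\mathbf{P})\times C_n(\mathbf{P})$ is pointwise reachable.
   Context: $C_n(\mathbf{P})$ and $C_{n,m}(\mathbf{P})$ denote the spaces of continuous functions on $\mathbf{P}$ with values in $\mathbb{C}^n$, respectively $\mathbb{C}^{n\times m}$. The pair $(A,B)$ is pointwise reachable if for every $\theta\in\mathbf{P}$ the pair $(A(\theta),B(\theta))\in\mathbb{C}^{n\times n}\times\mathbb{C}^{n\times m}$ is reachable, i.e. $\operatorname{rank}(B(\theta),A(\theta)B(\theta),\dots,A(\theta)^{n-1}B(\theta))=n$. Hermite indices: for a reachable pair $(A,B)\in\mathbb{C}^{n\times n}\times\mathbb{C}^{n\times m}$ with columns $b_1,\dots,b_m$ of $B$, consider the list $b_1,Ab_1,\dots,A^{n-1}b_1,\dots,b_m,Ab_m,\dots,A^{n-1}b_m$ and select, from left to right, the first linearly independent columns (a vector is selected iff it is not in the span of the vectors preceding it), obtaining $b_1,\dots,A^{h_1-1}b_1,b_2,\dots,A^{h_2-1}b_2,\dots,b_m,\dots,A^{h_m-1}b_m$. The numbers $h_1,\dots,h_m$ are the Hermite indices, with $h_i:=0$ if $b_i$ is not selected. The Hermite indices are constant if those of $(A(\theta),B(\theta))$ do not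 depend on $\theta\in\mathbf{P}$. *)

theory Defs
  imports "HOL-Analysis.Analysis"
begin

text \<open>
  The dimensions \<open>n\<close> and \<open>m\<close> are the cardinalities of the finite linearly ordered index
  types \<open>'n\<close> and \<open>'m\<close>. The order on \<open>'m\<close> is the numbering \<open>b\<^sub>1, \<dots>, b\<^sub>m\<close> of the columns of
  \<open>B\<close>, on which the Hermite indices depend. Linear independence, span and rank are over the
  complex field (\<open>vec.span\<close> and \<open>rank\<close>, as opposed to the real \<open>span\<close>).
\<close>

text \<open>The operator \<open>^\<close> is not available for matrix powers, since \<open>*\<close> is componentwise on vectors.\<close>

primrec matpow :: "complex^'n^'n \<Rightarrow> nat \<Rightarrow> complex^'n^'n" where
  "matpow A 0 = mat 1"
| "matpow A (Suc k) = A ** matpow A k"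

text \<open>The zero-based position of \<open>k\<close> in its index type: it runs through \<open>0, \<dots>, n - 1\<close>.\<close>

definition index_pos :: "'n::{finite,linorder} \<Rightarrow> nat" where
  "index_pos k = card {l. l < k}"

text \<open>
  The \<open>n \<times> (n m)\<close> block matrix \<open>(B, A B, \<dots>, A\<^sup>n\<^sup>-\<^sup>1 B)\<close>; its columns are indexed by pairs
  of a block \<open>k\<close> and a column \<open>j\<close> within that block.
\<close>

definition reachability_matrix ::
    "complex^('n::{finite,linorder})^('n::_) \<Rightarrow> complex^'m^('n::_) \<Rightarrow> complex^('n \<times> 'm::finite)^('n::_)" where
  "reachability_matrix A B = (\<chi> i c. (matpow A (index_pos (fst c)) ** B) $ i $ snd c)"

definition reachable :: "complex^('n::{finite,linorder})^('n::_) \<Rightarrow> complex^'m^('n::_) \<Rightarrow> bool" where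
  "reachable A B \<longleftrightarrow> rank (reachability_matrix A B) = CARD('n)"

definition pointwise_reachable ::
    "'p set \<Rightarrow> ('p \<Rightarrow> complex^('n::{finite,linorder})^('n::_)) \<Rightarrow> ('p \<Rightarrow> complex^'m^('n::_)) \<Rightarrow> bool" where
  "pointwise_reachable P A B \<longleftrightarrow> (\<forall>\<theta>\<in>P. reachable (A \<theta>) (B \<theta>))"

text \<open>
  The vectors to the left of \<open>A\<^sup>k b\<^sub>i\<close> in the list
  \<open>b\<^sub>1, A b\<^sub>1, \<dots>, A\<^sup>n\<^sup>-\<^sup>1 b\<^sub>1, \<dots>, b\<^sub>m, A b\<^sub>m, \<dots>, A\<^sup>n\<^sup>-\<^sup>1 b\<^sub>m\<close>.
\<close>

definition hermite_preceding ::
    "complex^'n^'n \<Rightarrow> complex^('m::{finite,linorder})^'n \<Rightarrow> 'm \<Rightarrow> nat \<Rightarrow> (complex^'n) set" where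
  "hermite_preceding A B i k =
     {matpow A l *v column j B | j l. l < CARD('n) \<and> (j < i \<or> j = i \<and> l < k)}"

definition hermite_selected ::
    "complex^'n^'n \<Rightarrow> complex^('m::{finite,linorder})^'n \<Rightarrow> 'm \<Rightarrow> nat \<Rightarrow> bool" where
  "hermite_selected A B i k \<longleftrightarrow>
     matpow A k *v column i B \<notin> vec.span (hermite_preceding A B i k)"

text \<open>
  The exponents \<open>k\<close> for which \<open>A\<^sup>k b\<^sub>i\<close> is selected form an initial segment
  \<open>{0, \<dots>, h\<^sub>i - 1}\<close> of \<open>{0, \<dots>, n - 1}\<close>, so \<open>h\<^sub>i\<close> is their number; in particular it is 0 if
  \<open>b\<^sub>i\<close> is not selected.
\<close>

definition hermite_index ::
    "complex^'n^'n \<Rightarrow> complex^('m::{finite,linorder})^'n \<Rightarrow> 'm \<Rightarrow> nat" where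
  "hermite_index A B i = card {k. k < CARD('n) \<and> hermite_selected A B i k}"

definition constant_hermite_indices ::
    "'p set \<Rightarrow> ('p \<Rightarrow> complex^'n^'n) \<Rightarrow> ('p \<Rightarrow> complex^('m::{finite,linorder})^'n) \<Rightarrow> bool" where
  "constant_hermite_indices P A B \<longleftrightarrow>
     (\<forall>\<theta>\<in>P. \<forall>\<theta>'\<in>P. \<forall>i. hermite_index (A \<theta>) (B \<theta>) i = hermite_index (A \<theta>') (B \<theta>') i)"

end

theory Submission
  imports Defs
begin

text \<open>
  At a fixed \<open>\<theta>\<close>, list the selected vectors of the Hermite list in order as \<open>t 0, \<dots>, t (n - 1)\<close>.
  Reachability makes them a basis. The matrix \<open>A\<close> sends \<open>t p\<close> to \<open>t (p + 1)\<close> as long as both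
  belong to the same column \<open>b\<^sub>i\<close>, and at the end of a block it sends \<open>t p\<close> into the span of
  \<open>t 0, \<dots>, t p\<close>, because the next vector of the list was rejected. So the only thing that keeps
  \<open>t 0\<close> from being a cyclic vector is the passage from one block to the next, and a feedback can
  enforce it: let \<open>K\<close> send the last vector of a block to the unit vector \<open>e\<^sub>j\<close> of the next column
  \<open>b\<^sub>j\<close> that occurs, and all other basis vectors to \<open>0\<close>. Since \<open>B e\<^sub>j = b\<^sub>j\<close> is the next basis
  vector, \<open>F = A + B K\<close> satisfies \<open>F (t p) - t (p + 1) \<in> span {t 0, \<dots>, t p}\<close> for all \<open>p\<close>. This
  triangular relation forces \<open>t 0, F (t 0), F\<^sup>2 (t 0), \<dots>\<close> to span the whole space
  (\<open>Krylov_span_triangular\<close>), and \<open>t 0 = B v\<close> for a unit vector \<open>v\<close>. This is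
  \<open>reachable_block_switch_feedback\<close>.

  The Hermite indices determine which positions of the list are selected (\<open>hermite_sel_eq\<close>). When
  they are constant, the vectors \<open>t p\<close> are given by the same formula at every \<open>\<theta>\<close>. Hence the matrix
  \<open>T \<theta>\<close> with columns \<open>t p\<close> is continuous in \<open>\<theta>\<close>, the values \<open>U\<close> of the feedback on the basis and
  the vector \<open>v\<close> do not depend on \<open>\<theta>\<close>, and \<open>K \<theta> = U (T \<theta>)\<^sup>-\<^sup>1\<close> is continuous by Cramer's rule.
\<close>

section \<open>Selecting a basis from a sequence of vectors\<close>

lemma (in vector_space) span_selected:
  fixes w :: "nat \<Rightarrow> 'b"
  shows "span (w ` {c. c < N \<and> w c \<notin> span (w ` {..<c})}) = span (w ` {..<N})"
proof (induction N)
  case 0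
  then show ?case by simp
next
  case (Suc N)
  let ?S = "\<lambda>N. {c. c < N \<and> w c \<notin> span (w ` {..<c})}"
  have ins: "w ` {..<Suc N} = insert (w N) (w ` {..<N})"
    by (auto simp: lessThan_Suc)
  show ?case
  proof (cases "w N \<in> span (w ` {..<N})")
    case True
    then have "?S (Suc N) = ?S N"
      by (auto simp: less_Suc_eq)
    then show ?thesis
      using Suc True by (simp only: ins span_redundant)
  next
    case False
    then have "?S (Suc N) = insert N (?S N)"
      by (auto simp: less_Suc_eq)
    then show ?thesis
      using Suc by (simp add: ins span_insert)
  qed
qed

lemma (in vector_space) independent_selected:
  fixes w :: "nat \<Rightarrow> 'b"
  assumes "finite C" and "\<And>c. c \<in> C \<Longrightarrow> w c \<notin> span (w ` {..<c})"
  shows "independent (w ` C) \<and> inj_on w C"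
  using assms
proof (induction C rule: finite_linorder_max_induct)
  case empty
  then show ?case by (simp add: independent_empty)
next
  case (insert c C)
  have "w ` C \<subseteq> w ` {..<c}"
    using insert by auto
  then have "w c \<notin> span (w ` C)"
    using insert.prems[of c] span_mono by blast
  then show ?case
    using insert by (auto simp: independent_insert inj_on_insert intro: span_base)
qed

text \<open>
  Each \<open>t (p + 1)\<close> is \<open>f (t p)\<close> up to earlier members of the sequence, so by induction it is
  reached by applying powers of \<open>f\<close> to \<open>t 0\<close>. The bound \<open>N\<close>
  is there because nothing is known about the image of the last basis vector.
\<close>

lemma (in vector_space) Krylov_span_triangular:
  fixes f :: "'b \<Rightarrow> 'b" and t :: "nat \<Rightarrow> 'b"
  assumes lin: "Vector_Spaces.linear scale scale f"
    and step: "\<And>p. Suc p < N \<Longrightarrow> f (t p) - t (Suc p) \<in> span (t ` {..p})"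
    and "p < N"
  shows "t p \<in> span ((\<lambda>l. (f ^^ l) (t 0)) ` {..p})"
  using \<open>p < N\<close>
proof (induction p rule: less_induct)
  case (less p)
  interpret f: Vector_Spaces.linear scale scale f by (fact lin)
  let ?X = "\<lambda>p. (\<lambda>l. (f ^^ l) (t 0)) ` {..p}"
  show ?case
  proof (cases p)
    case 0
    then show ?thesis by (auto intro: span_base)
  next
    case (Suc q)
    have mono: "span (?X r) \<subseteq> span (?X p)" if "r \<le> p" for r
      using that by (intro span_mono image_mono) auto
    have "t ` {..q} \<subseteq> span (?X p)"
    proof safe
      fix r assume "r \<le> q"
      then show "t r \<in> span (?X p)"
        using less.IH[of r] less.prems mono[of r] Suc by auto
    qed
    then have "span (t ` {..q}) \<subseteq> span (?X p)"
      by (simp add: span_minimal)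
    then have s: "f (t q) - t p \<in> span (?X p)"
      using step[of q] less.prems Suc by auto
    have "f (t q) \<in> f ` span (?X q)"
      using less.IH[of q] less.prems Suc by auto
    also have "f ` span (?X q) = span (f ` ?X q)"
      by (rule f.span_image[symmetric])
    also have "\<dots> \<subseteq> span (?X p)"
    proof (intro span_mono subsetI)
      fix y assume "y \<in> f ` ?X q"
      then obtain l where "l \<le> q" "y = (f ^^ Suc l) (t 0)" by auto
      then show "y \<in> ?X p" using Suc by blast
    qed
    finally have "f (t q) \<in> span (?X p)" .
    from span_diff[OF this s] show ?thesis by simp
  qed
qed

section \<open>Powers of a matrix applied to a vector\<close>

lemma matpow_vec: "matpow A l *v x = (((*v) A) ^^ l) x"
  by (induction l) (simp_all add: matrix_vector_mul_assoc[symmetric])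

text \<open>
  Cayley--Hamilton for one vector, by dimension count: among the \<open>n + 1\<close> vectors \<open>A\<^sup>l b\<close> with
  \<open>l \<le> n\<close> some \<open>A\<^sup>k b\<close> depends on its predecessors. The span of these predecessors is then
  \<open>A\<close>-invariant and so contains all higher powers.
\<close>

lemma matpow_card_in_span:
  fixes A :: "complex^'n^'n"
  shows "matpow A CARD('n) *v b \<in> vec.span ((\<lambda>l. matpow A l *v b) ` {..<CARD('n)})"
proof -
  let ?x = "\<lambda>l. matpow A l *v b"
  have "\<exists>k\<le>CARD('n). ?x k \<in> vec.span (?x ` {..<k})"
  proof (rule ccontr)
    assume "\<not> ?thesis"
    then have "vec.independent (?x ` {..CARD('n)}) \<and> inj_on ?x {..CARD('n)}"
      by (intro vec.independent_selected) auto
    then have "card (?x ` {..CARD('n)}) \<le> CARD('n)" "card (?x ` {..CARD('n)}) = Suc CARD('n)"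
      using vec.independent_card_le_dim[of "?x ` {..CARD('n)}" UNIV]
      by (simp_all add: card_image card_cart_basis)
    then show False by simp
  qed
  then obtain k where k: "k \<le> CARD('n)" "?x k \<in> vec.span (?x ` {..<k})" by blast
  let ?S = "vec.span (?x ` {..<k})"
  have "(*v) A ` ?S = vec.span ((*v) A ` ?x ` {..<k})"
    by (rule vec.span_image[symmetric])
  also have "\<dots> \<subseteq> ?S"
  proof (rule vec.span_minimal)
    show "(*v) A ` ?x ` {..<k} \<subseteq> ?S"
    proof clarify
      fix l assume "l < k"
      have "?x (Suc l) \<in> ?S"
      proof (cases "Suc l = k")
        case False
        then show ?thesis using \<open>l < k\<close> by (intro vec.span_base imageI) simp
      qed (use k in simp)
      then show "A *v ?x l \<in> ?S" by (simp add: matrix_vector_mul_assoc)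
    qed
  qed simp
  finally have inv: "(*v) A ` ?S \<subseteq> ?S" .
  have "?x (k + l) \<in> ?S" for l
  proof (induction l)
    case 0
    show ?case using k by simp
  next
    case (Suc l)
    have "?x (k + Suc l) = A *v ?x (k + l)" by (simp add: matrix_vector_mul_assoc)
    then show ?case using Suc inv by auto
  qed
  from this[of "CARD('n) - k"] have "?x CARD('n) \<in> ?S" using k by simp
  moreover have "?S \<subseteq> vec.span (?x ` {..<CARD('n)})"
    using k by (intro vec.span_mono image_mono) auto
  ultimately show ?thesis by blast
qed

section \<open>Positions in a finite linear order\<close>

lemma index_pos_strict_mono: "strict_mono (index_pos :: 'k::{finite,linorder} \<Rightarrow> nat)"
proof (rule strict_monoI)
  fix j k :: 'k assume "j < k"
  then have "{l. l < j} \<subset> {l. l < k}" by auto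
  then show "index_pos j < index_pos k"
    unfolding index_pos_def by (intro psubset_card_mono) auto
qed

lemma inj_index_pos: "inj (index_pos :: 'k::{finite,linorder} \<Rightarrow> nat)"
  by (rule strict_mono_imp_inj_on[OF index_pos_strict_mono])

lemma index_pos_less_iff [simp]: "index_pos j < index_pos k \<longleftrightarrow> j < (k :: 'k::{finite,linorder})"
  by (rule strict_mono_less[OF index_pos_strict_mono])

lemma index_pos_less_card [simp]: "index_pos (k :: 'k::{finite,linorder}) < CARD('k)"
  unfolding index_pos_def by (intro psubset_card_mono) auto

lemma range_index_pos: "range (index_pos :: 'k::{finite,linorder} \<Rightarrow> nat) = {..<CARD('k)}"
  by (rule card_subset_eq) (auto simp: card_image[OF inj_index_pos])

definition index_at :: "nat \<Rightarrow> 'k::{finite,linorder}" where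
  "index_at = inv index_pos"

lemma index_at_index_pos [simp]: "index_at (index_pos k) = k"
  unfolding index_at_def by (rule inv_f_f[OF inj_index_pos])

lemma index_pos_index_at [simp]:
  "p < CARD('k) \<Longrightarrow> index_pos (index_at p :: 'k::{finite,linorder}) = p"
  unfolding index_at_def by (rule f_inv_into_f) (simp add: range_index_pos)

section \<open>Reachability as a spanning condition\<close>

lemma matrix_vector_mult_axis: "M *v axis k 1 = column k (M :: 'a::comm_semiring_1^'n^'m)"
  by (simp add: matrix_vector_mult_def column_def axis_def vec_eq_iff if_distrib cong: if_cong)

lemma column_matrix_mult: "column j (M ** N) = M *v column j (N :: 'a::comm_semiring_1^'n^'m)"
  by (simp add: matrix_vector_mult_axis[symmetric] matrix_vector_mul_assoc)

text \<open>
  The constant \<open>rank\<close> is the dimension of the row space. Full row rank means that the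
  rows are linearly independent as a family, which is the existence of a right inverse.
\<close>

lemma rank_eq_rows_iff_span_columns:
  fixes M :: "'a::field^'m^'n"
  shows "rank M = CARD('n) \<longleftrightarrow> vec.span (columns M) = UNIV"
proof -
  let ?ind = "\<forall>c. (\<Sum>i\<in>UNIV. c i *s row i M) = 0 \<longrightarrow> (\<forall>i. c i = 0)"
  have rows: "rows M = range (\<lambda>i. row i M)"
    by (auto simp: rows_def)
  have "vec.dim (rows M) = CARD('n) \<longleftrightarrow> ?ind"
  proof
    assume dim: "vec.dim (rows M) = CARD('n)"
    have "card (rows M) \<le> CARD('n)"
      unfolding rows by (rule card_image_le) simp
    moreover have "vec.dim (rows M) \<le> card (rows M)"
      by (rule vec.dim_le_card) (auto simp: rows vec.span_superset)
    ultimately have card: "card (rows M) = CARD('n)"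
      using dim by simp
    then have ind: "vec.independent (rows M)"
      using dim by (intro vec.card_le_dim_spanning[of _ "rows M"]) (auto simp: rows vec.span_superset)
    have inj: "inj (\<lambda>i. row i M)"
      using card unfolding rows by (intro eq_card_imp_inj_on) auto
    show ?ind
    proof (intro allI impI)
      fix c i assume sum: "(\<Sum>i\<in>UNIV. c i *s row i M) = 0"
      let ?u = "\<lambda>v. c (inv (\<lambda>i. row i M) v)"
      have "(\<Sum>v\<in>rows M. ?u v *s v) = (\<Sum>i\<in>UNIV. c i *s row i M)"
        unfolding rows using inj by (simp add: sum.reindex inv_f_f[OF inj, simplified])
      then have "?u (row i M) = 0"
        using sum by (intro vec.independentD[OF ind, of "rows M" ?u]) (auto simp: rows)
      then show "c i = 0" by (simp add: inv_f_f[OF inj, simplified])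
    qed
  next
    assume ind: ?ind
    have inj: "inj (\<lambda>i. row i M)"
    proof (rule injI, rule ccontr)
      fix i j assume eq: "row i M = row j M" and "i \<noteq> j"
      let ?c = "\<lambda>k. if k = i then 1 else if k = j then - 1 else (0 :: 'a)"
      have "(\<Sum>k\<in>UNIV. ?c k *s row k M) = (\<Sum>k\<in>{i, j}. ?c k *s row k M)"
        by (rule sum.mono_neutral_right) auto
      also have "\<dots> = 0" using \<open>i \<noteq> j\<close> eq by simp
      finally have "\<forall>k. ?c k = 0" using ind[rule_format, of ?c] by blast
      then show False by (auto dest: spec[of _ i])
    qed
    have "vec.independent (rows M)"
    proof (subst vec.independent_explicit, intro conjI allI impI ballI)
      show "finite (rows M)" by (simp add: rows)
    next
      fix u v assume sum: "(\<Sum>v\<in>rows M. u v *s v) = 0" and "v \<in> rows M"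
      have "(\<Sum>i\<in>UNIV. u (row i M) *s row i M) = 0"
        using sum inj by (simp add: rows sum.reindex)
      then have "\<forall>i. u (row i M) = 0"
        using ind[rule_format, of "\<lambda>i. u (row i M)"] by blast
      then show "u v = 0" using \<open>v \<in> rows M\<close> by (auto simp: rows)
    qed
    then have "vec.dim (rows M) = card (rows M)"
      by (rule vec.dim_eq_card_independent)
    then show "vec.dim (rows M) = CARD('n)"
      using inj by (simp add: rows card_image)
  qed
  then show ?thesis
    unfolding row_rank_def_gen matrix_right_invertible_span_columns[symmetric]
      matrix_right_invertible_independent_rows by simp
qed

lemma reachable_iff_span:
  "reachable A B \<longleftrightarrow>
     vec.span {matpow A l *v column j B | j l. l < CARD('n)} = (UNIV :: (complex^'n::{finite,linorder}) set)"
proof -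
  have col: "column (k, j) (reachability_matrix A B) = matpow A (index_pos k) *v column j B" for k j
    unfolding column_matrix_mult[symmetric] by (simp add: reachability_matrix_def column_def)
  have "columns (reachability_matrix A B) = {matpow A l *v column j B | j l. l < CARD('n)}"
  proof safe
    fix x assume "x \<in> columns (reachability_matrix A B)"
    then show "\<exists>j l. x = matpow A l *v column j B \<and> l < CARD('n)"
      by (force simp: columns_def col)
  next
    fix j l assume "l < CARD('n)"
    then have "matpow A l *v column j B = column (index_at l, j) (reachability_matrix A B)"
      by (simp add: col)
    then show "matpow A l *v column j B \<in> columns (reachability_matrix A B)"
      by (auto simp: columns_def)
  qed
  then show ?thesis
    by (simp add: reachable_def rank_eq_rows_iff_span_columns)
qed

section \<open>The Hermite list as a sequence\<close>

text \<open>
  The member \<open>A\<^sup>k b\<^sub>i\<close> of the Hermite list gets the number \<open>i n + k\<close>, with \<open>i\<close> counted from \<open>0\<close>. The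
  order of the list becomes the order of the natural numbers, so that prefixes are initial segments,
  and a number divisible by \<open>n\<close> marks the start of a block.
\<close>

definition hermite_vec ::
    "complex^'n^'n \<Rightarrow> complex^('m::{finite,linorder})^'n \<Rightarrow> nat \<Rightarrow> complex^'n" where
  "hermite_vec A B c = matpow A (c mod CARD('n)) *v column (index_at (c div CARD('n))) B"

lemma hermite_vec_block:
  fixes A :: "complex^'n^'n" and i :: "'m::{finite,linorder}"
  assumes "k < CARD('n)"
  shows "hermite_vec A B (index_pos i * CARD('n) + k) = matpow A k *v column i B"
  using assms by (simp add: hermite_vec_def)

lemma block_code:
  assumes "c < CARD('m::{finite,linorder}) * CARD('n::finite)"
  obtains i :: "'m::{finite,linorder}" and k
  where "k < CARD('n::finite)" "c = index_pos i * CARD('n) + k"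
proof
  have "c div CARD('n) < CARD('m)"
    using assms by (simp add: less_mult_imp_div_less)
  then show "c = index_pos (index_at (c div CARD('n)) :: 'm) * CARD('n) + c mod CARD('n)"
    by simp
qed simp

lemma block_code_less:
  fixes n :: nat
  assumes "k < n" "l < n"
  shows "i * n + k < j * n + l \<longleftrightarrow> i < j \<or> i = j \<and> k < l"
proof -
  have "i * n + k < j * n + l" if "i < j" "k < n" for i j k l
  proof -
    have "i * n + k < Suc i * n" using that by simp
    also have "\<dots> \<le> j * n" using that by (intro mult_le_mono1) simp
    finally show ?thesis by simp
  qed
  from this[of i j k l] this[of j i l k] show ?thesis
    using assms by (cases i j rule: linorder_cases) auto
qed

lemma block_code_less_total:
  assumes "k < CARD('n)"
  shows "index_pos (i :: 'm::{finite,linorder}) * CARD('n::finite) + k < CARD('m) * CARD('n)"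
  using block_code_less[of k "CARD('n)" 0 "index_pos i" "CARD('m)"] assms by simp

lemma hermite_preceding_eq:
  fixes A :: "complex^'n^'n" and i :: "'m::{finite,linorder}"
  assumes "k < CARD('n)"
  shows "hermite_preceding A B i k = hermite_vec A B ` {..<index_pos i * CARD('n) + k}"
proof (intro equalityI subsetI)
  fix x assume "x \<in> hermite_preceding A B i k"
  then obtain j l where l: "x = matpow A l *v column j B" "l < CARD('n)" "j < i \<or> j = i \<and> l < k"
    unfolding hermite_preceding_def by blast
  then show "x \<in> hermite_vec A B ` {..<index_pos i * CARD('n) + k}"
    using assms
    by (intro image_eqI[of _ _ "index_pos j * CARD('n) + l"])
       (auto simp: hermite_vec_block block_code_less)
next
  fix x assume "x \<in> hermite_vec A B ` {..<index_pos i * CARD('n) + k}"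
  then obtain c where c: "x = hermite_vec A B c" "c < index_pos i * CARD('n) + k" by auto
  then have "c < CARD('m) * CARD('n)"
    using block_code_less_total[OF assms, of i] by simp
  then obtain j :: 'm and l where jl: "l < CARD('n)" "c = index_pos j * CARD('n) + l"
    by (rule block_code)
  then have "j < i \<or> j = i \<and> l < k"
    using c assms by (auto simp: block_code_less inj_eq[OF inj_index_pos])
  then show "x \<in> hermite_preceding A B i k"
    unfolding hermite_preceding_def using jl c by (auto simp: hermite_vec_block)
qed

lemma reachable_iff_span_hermite_vec:
  fixes A :: "complex^('n::{finite,linorder})^('n::_)" and B :: "complex^('m::{finite,linorder})^('n::_)"
  shows "reachable A B \<longleftrightarrow> vec.span (hermite_vec A B ` {..<CARD('m) * CARD('n)}) = UNIV"
proof -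
  have "{matpow A l *v column j B | j l. l < CARD('n)} = hermite_vec A B ` {..<CARD('m) * CARD('n)}"
  proof safe
    fix j l assume "l < CARD('n)"
    then show "matpow A l *v column j B \<in> hermite_vec A B ` {..<CARD('m) * CARD('n)}"
      by (intro image_eqI[of _ _ "index_pos j * CARD('n) + l"])
        (auto simp: hermite_vec_block block_code_less_total)
  next
    fix c assume "c < CARD('m) * CARD('n)"
    then obtain j :: 'm and l where "l < CARD('n)" "c = index_pos j * CARD('n) + l"
      by (rule block_code)
    then show "\<exists>j l. hermite_vec A B c = matpow A l *v column j B \<and> l < CARD('n)"
      using hermite_vec_block by blast
  qed
  then show ?thesis by (simp add: reachable_iff_span)
qed

lemma mult_hermite_vec_within_block:
  fixes A :: "complex^'n^'n"
  assumes "Suc c mod CARD('n) \<noteq> 0"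
  shows "A *v hermite_vec A B c = hermite_vec A B (Suc c)"
proof -
  have "Suc c mod CARD('n) = Suc (c mod CARD('n))" "Suc c div CARD('n) = c div CARD('n)"
    using assms by (auto simp: mod_Suc div_Suc split: if_splits)
  then show ?thesis
    by (simp add: hermite_vec_def matrix_vector_mul_assoc)
qed

text \<open>
  The list is cut off at \<open>A\<^sup>n\<^sup>-\<^sup>1 b\<^sub>i\<close>; the vector \<open>A\<^sup>n b\<^sub>i\<close> that would come next depends on the
  block itself.
\<close>

lemma mult_hermite_vec_end_of_block:
  fixes A :: "complex^'n^'n"
  assumes "Suc c mod CARD('n) = 0"
  shows "A *v hermite_vec A B c \<in> vec.span (hermite_vec A B ` {..c})"
proof -
  let ?i = "c div CARD('n)" and ?b = "column (index_at (c div CARD('n))) B"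
  have last: "Suc (c mod CARD('n)) = CARD('n)"
    using assms by (auto simp: mod_Suc split: if_splits)
  then have eq: "A *v hermite_vec A B c = matpow A CARD('n) *v ?b"
    unfolding hermite_vec_def by (metis matpow.simps(2) matrix_vector_mul_assoc)
  have sub: "(\<lambda>l. matpow A l *v ?b) ` {..<CARD('n)} \<subseteq> hermite_vec A B ` {..c}"
  proof clarify
    fix l assume "l < CARD('n)"
    moreover have "c = ?i * CARD('n) + c mod CARD('n)" by simp
    ultimately have "?i * CARD('n) + l \<le> c" using last by linarith
    moreover have "matpow A l *v ?b = hermite_vec A B (?i * CARD('n) + l)"
      using \<open>l < CARD('n)\<close> by (simp add: hermite_vec_def)
    ultimately show "matpow A l *v ?b \<in> hermite_vec A B ` {..c}" by blast
  qed
  have "matpow A CARD('n) *v ?b \<in> vec.span (hermite_vec A B ` {..c})"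
    by (rule subsetD[OF vec.span_mono[OF sub] matpow_card_in_span])
  with eq show ?thesis by simp
qed

section \<open>The selected positions\<close>

definition hermite_sel :: "complex^'n^'n \<Rightarrow> complex^('m::{finite,linorder})^'n \<Rightarrow> nat set" where
  "hermite_sel A B = {c. c < CARD('m) * CARD('n) \<and>
     hermite_vec A B c \<notin> vec.span (hermite_vec A B ` {..<c})}"

lemma finite_hermite_sel [simp]: "finite (hermite_sel A B)"
  unfolding hermite_sel_def by simp

lemma span_hermite_sel_prefix:
  fixes A :: "complex^'n^'n" and B :: "complex^('m::{finite,linorder})^'n"
  assumes "N \<le> CARD('m) * CARD('n)"
  shows "vec.span (hermite_vec A B ` (hermite_sel A B \<inter> {..<N})) = vec.span (hermite_vec A B ` {..<N})"
proof -
  have "hermite_sel A B \<inter> {..<N} = {c. c < N \<and> hermite_vec A B c \<notin> vec.span (hermite_vec A B ` {..<c})}"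
    unfolding hermite_sel_def using assms by auto
  then show ?thesis using vec.span_selected[of "hermite_vec A B" N] by simp
qed

lemma hermite_selected_iff:
  fixes A :: "complex^'n^'n" and i :: "'m::{finite,linorder}"
  assumes "k < CARD('n)"
  shows "hermite_selected A B i k \<longleftrightarrow> index_pos i * CARD('n) + k \<in> hermite_sel A B"
  using assms
  by (simp add: hermite_selected_def hermite_sel_def hermite_preceding_eq hermite_vec_block
      block_code_less_total)

text \<open>
  Once a vector is rejected, so is the rest of its block: multiplication by \<open>A\<close> carries the span of
  the predecessors of position \<open>c\<close> into the span of the predecessors of position \<open>c + 1\<close>.
\<close>

lemma hermite_sel_pred:
  fixes A :: "complex^'n^'n" and B :: "complex^('m::{finite,linorder})^'n"
  assumes "Suc c \<in> hermite_sel A B" and "Suc c mod CARD('n) \<noteq> 0"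
  shows "c \<in> hermite_sel A B"
proof (rule ccontr)
  let ?w = "hermite_vec A B"
  assume "c \<notin> hermite_sel A B"
  then have "?w c \<in> vec.span (?w ` {..<c})"
    using assms by (simp add: hermite_sel_def)
  then have "A *v ?w c \<in> (*v) A ` vec.span (?w ` {..<c})" by blast
  also have "\<dots> = vec.span ((*v) A ` ?w ` {..<c})"
    by (rule vec.span_image[symmetric])
  also have "\<dots> \<subseteq> vec.span (?w ` {..<Suc c})"
  proof (rule vec.span_minimal)
    show "(*v) A ` ?w ` {..<c} \<subseteq> vec.span (?w ` {..<Suc c})"
    proof clarify
      fix d assume "d < c"
      have "vec.span (?w ` {..d}) \<subseteq> vec.span (?w ` {..<Suc c})"
        using \<open>d < c\<close> by (intro vec.span_mono image_mono) auto
      moreover have "?w (Suc d) \<in> vec.span (?w ` {..<Suc c})"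
        using \<open>d < c\<close> by (intro vec.span_base) auto
      ultimately show "A *v ?w d \<in> vec.span (?w ` {..<Suc c})"
        using mult_hermite_vec_within_block[of d A B] mult_hermite_vec_end_of_block[of d A B]
        by (cases "Suc d mod CARD('n) = 0") auto
    qed
  qed simp
  finally show False
    using assms mult_hermite_vec_within_block[of c A B] by (simp add: hermite_sel_def)
qed

lemma downward_closed_eq_lessThan_card:
  assumes "\<And>k. Suc k \<in> S \<Longrightarrow> k \<in> S" and "finite (S :: nat set)"
  shows "S = {..<card S}"
proof -
  have down: "k \<in> S" if "l \<in> S" "k \<le> l" for k l
    using that(2,1) by (induction rule: inc_induct) (auto intro: assms(1))
  have "\<exists>h. S = {..<h}"
  proof (cases "S = {}")
    case False
    then have "S = {..<Suc (Max S)}"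
      using down[of "Max S"] Max_ge[OF assms(2)] Max_in[OF assms(2)] by (auto simp: less_Suc_eq_le)
    then show ?thesis by blast
  qed auto
  then show ?thesis by auto
qed

text \<open>
  The selected exponents of a block form an initial segment, whose length is the Hermite index.
  Therefore the right-hand side depends on \<open>A\<close> and \<open>B\<close> through the Hermite indices only.
\<close>

lemma hermite_sel_eq:
  fixes A :: "complex^'n^'n" and B :: "complex^('m::{finite,linorder})^'n"
  shows "hermite_sel A B = {c. c < CARD('m) * CARD('n) \<and>
    c mod CARD('n) < hermite_index A B (index_at (c div CARD('n)))}"
proof -
  have seg: "{k. k < CARD('n) \<and> hermite_selected A B i k} = {..<hermite_index A B i}" for i
    unfolding hermite_index_def
  proof (rule downward_closed_eq_lessThan_card)
    fix k assume *: "Suc k \<in> {k. k < CARD('n) \<and> hermite_selected A B i k}"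
    then have "Suc (index_pos i * CARD('n) + k) mod CARD('n) = Suc k"
      by (simp flip: add_Suc_right)
    then show "k \<in> {k. k < CARD('n) \<and> hermite_selected A B i k}"
      using * hermite_sel_pred[of "index_pos i * CARD('n) + k" A B]
      by (auto simp: hermite_selected_iff)
  qed simp
  have "c \<in> hermite_sel A B \<longleftrightarrow> c mod CARD('n) < hermite_index A B (index_at (c div CARD('n)))"
    if c: "c < CARD('m) * CARD('n)" for c
  proof -
    obtain i :: 'm and k where k: "k < CARD('n)" "c = index_pos i * CARD('n) + k"
      using c by (rule block_code)
    then have "c \<in> hermite_sel A B \<longleftrightarrow> k \<in> {k. k < CARD('n) \<and> hermite_selected A B i k}"
      by (simp add: hermite_selected_iff)
    also have "\<dots> \<longleftrightarrow> k < hermite_index A B i" unfolding seg by simp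
    finally show ?thesis using k by simp
  qed
  then show ?thesis by (auto simp: hermite_sel_def)
qed

lemma
  fixes A :: "complex^('n::{finite,linorder})^('n::_)" and B :: "complex^('m::{finite,linorder})^('n::_)"
  assumes "reachable A B"
  shows card_hermite_sel: "card (hermite_sel A B) = CARD('n)"
    and span_hermite_sel: "vec.span (hermite_vec A B ` hermite_sel A B) = UNIV"
proof -
  have "hermite_sel A B \<inter> {..<CARD('m) * CARD('n)} = hermite_sel A B"
    by (auto simp: hermite_sel_def)
  then show span: "vec.span (hermite_vec A B ` hermite_sel A B) = UNIV"
    using span_hermite_sel_prefix[of "CARD('m) * CARD('n)" A B] assms
    by (simp add: reachable_iff_span_hermite_vec)
  have ind: "vec.independent (hermite_vec A B ` hermite_sel A B) \<and> inj_on (hermite_vec A B) (hermite_sel A B)"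
    by (rule vec.independent_selected) (auto simp: hermite_sel_def)
  then have "card (hermite_sel A B) = vec.dim (hermite_vec A B ` hermite_sel A B)"
    by (simp add: vec.dim_eq_card_independent card_image)
  also have "\<dots> = vec.dim (UNIV :: (complex^('n::_)) set)"
    using span vec.dim_span by metis
  finally show "card (hermite_sel A B) = CARD('n)"
    by (simp add: card_cart_basis)
qed

section \<open>The feedback that links consecutive blocks\<close>

lemma enumerate_finite_surj:
  assumes "finite (S :: nat set)" "c \<in> S"
  obtains p where "p < card S" "enumerate S p = c"
  using finite_enumerate_Ex[OF assms(1)] assms by (metis)

lemma enumerate_image_atMost:
  assumes "finite (S :: nat set)" "p < card S"
  shows "enumerate S ` {..p} = S \<inter> {..enumerate S p}"
proof (intro equalityI subsetI)
  fix c assume "c \<in> enumerate S ` {..p}"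
  then obtain q where "q \<le> p" "c = enumerate S q" by auto
  then show "c \<in> S \<inter> {..enumerate S p}"
    using assms finite_enumerate_in_set[of S q] finite_enumerate_mono[of q p S]
    by (cases "q = p") (auto intro: less_imp_le)
next
  fix c assume c: "c \<in> S \<inter> {..enumerate S p}"
  then obtain q where q: "q < card S" "enumerate S q = c"
    using enumerate_finite_surj[of S c] assms by auto
  then have "\<not> p < q"
    using c assms finite_enumerate_mono[of p q S] by auto
  then show "c \<in> enumerate S ` {..p}" using q by auto
qed


text \<open>
  The value of the feedback on the \<open>p\<close>-th vector of the Hermite basis, where \<open>C\<close> is the set of
  selected positions: if the next basis vector starts a new block, the unit vector of that block.
  At the last \<open>p\<close> there is no next basis vector, and the value there is arbitrary.
\<close>

definition block_switch :: "nat \<Rightarrow> nat set \<Rightarrow> nat \<Rightarrow> complex^'m::{finite,linorder}" where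
  "block_switch n C p =
     (if enumerate C (Suc p) mod n = 0 then axis (index_at (enumerate C (Suc p) div n)) 1 else 0)"

text \<open>
  If the basis stays in the current block, then \<open>A\<close> alone takes \<open>t p\<close> to \<open>t (p + 1)\<close> and the
  feedback is silent. If a new block starts, then the feedback supplies \<open>t (p + 1)\<close>, and \<open>A (t p)\<close>
  depends on \<open>t 0, \<dots>, t p\<close>: it is either a rejected member of the list or \<open>A\<^sup>n b\<^sub>i\<close>.
\<close>

lemma reachable_block_switch_feedback:
  fixes A :: "complex^('n::{finite,linorder})^('n::_)" and B :: "complex^('m::{finite,linorder})^('n::_)"
    and K :: "complex^('n::_)^('m::_)"
  defines "r \<equiv> enumerate (hermite_sel A B)"
  assumes reach: "reachable A B"
    and K: "\<And>p. Suc p < CARD('n) \<Longrightarrow>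
      K *v hermite_vec A B (r p) = block_switch CARD('n) (hermite_sel A B) p"
  shows "reachable (A + B ** K)
    (columnvector (B *v axis (index_at (r 0 div CARD('n))) 1) :: complex^1^('n::_))"
proof -
  let ?n = "CARD('n)" and ?C = "hermite_sel A B" and ?w = "hermite_vec A B" and ?F = "A + B ** K"
  define t where "t p = ?w (r p)" for p
  have card: "card ?C = ?n" by (rule card_hermite_sel[OF reach])
  have rC: "r p \<in> ?C" if "p < ?n" for p
    unfolding r_def by (rule finite_enumerate_in_set) (use that card in auto)
  have mono: "r p < r q" if "p < q" "q < ?n" for p q
    unfolding r_def by (rule finite_enumerate_mono) (use that card in auto)
  have surj: "\<exists>p<?n. r p = c" if "c \<in> ?C" for c
    using enumerate_finite_surj[of ?C c] that card unfolding r_def by auto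
  have gap: "c \<notin> ?C" if "r p < c" "c < r (Suc p)" "Suc p < ?n" for p c
  proof
    assume "c \<in> ?C"
    then obtain q where q: "q < ?n" "r q = c" using surj by blast
    have "q \<le> p \<or> q = Suc p \<or> Suc p < q" by auto
    then show False
      using that q mono[of q p] mono[of "Suc p" q] by (auto simp: le_less)
  qed
  \<comment> \<open>The first selected position starts a block, since inside a block its predecessor would be selected too.\<close>
  have start: "r 0 mod ?n = 0"
  proof (rule ccontr)
    assume "r 0 mod ?n \<noteq> 0"
    then obtain c where c: "r 0 = Suc c" by (cases "r 0") auto
    then have "c \<in> ?C"
      using hermite_sel_pred[of c A B] rC[of 0] \<open>r 0 mod ?n \<noteq> 0\<close> by simp
    then obtain q where "q < ?n" "r q = c" using surj by blast
    then show False using c mono[of 0 q] by (cases "q = 0") auto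
  qed
  have t_start: "t p = B *v axis (index_at (r p div ?n)) 1" if "r p mod ?n = 0" for p
    using that by (simp add: t_def hermite_vec_def matrix_vector_mult_axis)
  have prefix: "vec.span (?w ` {..r p}) = vec.span (t ` {..p})" if "p < ?n" for p
  proof -
    have "?C \<inter> {..<Suc (r p)} = r ` {..p}"
      using enumerate_image_atMost[of ?C p] that card unfolding r_def lessThan_Suc_atMost by simp
    moreover have "Suc (r p) \<le> CARD('m) * ?n"
      using rC[OF that] by (simp add: hermite_sel_def)
    ultimately show ?thesis
      using span_hermite_sel_prefix[of "Suc (r p)" A B]
      by (simp add: lessThan_Suc_atMost image_image t_def)
  qed
  have step: "?F *v t p - t (Suc p) \<in> vec.span (t ` {..p})" if p: "Suc p < ?n" for p
  proof -
    have F: "?F *v t p = A *v t p + B *v block_switch ?n ?C p"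
      using K[OF p] by (simp add: t_def matrix_vector_mult_add_rdistrib flip: matrix_vector_mul_assoc)
    show ?thesis
    proof (cases "r (Suc p) mod ?n = 0")
      case False
      then obtain c where c: "r (Suc p) = Suc c" by (cases "r (Suc p)") auto
      then have "c \<in> ?C"
        using hermite_sel_pred[of c A B] rC[OF p] False by simp
      then have "r p = c"
        using gap[of p c] mono[of p "Suc p"] c p by force
      then have "A *v t p = t (Suc p)"
        using mult_hermite_vec_within_block[of c A B] False c by (simp add: t_def)
      moreover have "block_switch ?n ?C p = (0 :: complex^('m::_))"
        using False by (simp add: block_switch_def r_def)
      ultimately show ?thesis by (simp add: F vec.span_zero)
    next
      case True
      then have "B *v block_switch ?n ?C p = t (Suc p)"
        using t_start[of "Suc p"] by (simp add: block_switch_def r_def)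
      moreover have "A *v t p \<in> vec.span (t ` {..p})"
      proof (cases "Suc (r p) mod ?n = 0")
        case True
        then show ?thesis
          using mult_hermite_vec_end_of_block[of "r p" A B] prefix[of p] p by (simp add: t_def)
      next
        case False
        then have "Suc (r p) \<noteq> r (Suc p)" using True by auto
        then have less: "Suc (r p) < r (Suc p)" using mono[of p "Suc p"] p by simp
        then have "Suc (r p) \<notin> ?C" using gap[of p "Suc (r p)"] p by simp
        moreover have "Suc (r p) < CARD('m) * ?n"
          using less rC[OF p] by (simp add: hermite_sel_def)
        ultimately have "?w (Suc (r p)) \<in> vec.span (?w ` {..r p})"
          by (simp add: hermite_sel_def lessThan_Suc_atMost)
        then show ?thesis
          using mult_hermite_vec_within_block[OF False, of A B] prefix[of p] p by (simp add: t_def)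
      qed
      ultimately show ?thesis by (simp add: F)
    qed
  qed
  let ?b = "B *v axis (index_at (r 0 div ?n)) 1"
  let ?X = "{matpow ?F l *v column j (columnvector ?b :: complex^1^('n::_)) | j l. l < ?n}"
  \<comment> \<open>The starting vector \<open>B v\<close> of the single-input system is the first basis vector.\<close>
  have col: "column j (columnvector ?b :: complex^1^('n::_)) = t 0" for j
    using t_start[OF start] by (simp add: column_def columnvector_def vec_eq_iff)
  have "t p \<in> vec.span ?X" if "p < ?n" for p
  proof -
    have "t p \<in> vec.span ((\<lambda>l. (((*v) ?F) ^^ l) (t 0)) ` {..p})"
      by (rule vec.Krylov_span_triangular[where N = ?n]) (use that step in auto)
    moreover have "(\<lambda>l. (((*v) ?F) ^^ l) (t 0)) ` {..p} \<subseteq> ?X"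
      using that by (auto simp: col matpow_vec)
    ultimately show ?thesis using vec.span_mono by blast
  qed
  then have "?w ` ?C \<subseteq> vec.span ?X"
    using surj by (force simp: t_def)
  then have "vec.span (?w ` ?C) \<subseteq> vec.span ?X"
    by (simp add: vec.span_minimal)
  then show ?thesis
    unfolding reachable_iff_span using span_hermite_sel[OF reach] by blast
qed

section \<open>Continuity\<close>

lemma continuous_on_matrix_mult [continuous_intros]:
  fixes F :: "'a::topological_space \<Rightarrow> 'b::real_normed_field^'k^'l" and G :: "'a \<Rightarrow> 'b::real_normed_field^'j^'k"
  assumes "continuous_on S F" "continuous_on S G"
  shows "continuous_on S (\<lambda>x. F x ** G x)"
  unfolding matrix_matrix_mult_def by (intro continuous_intros assms)

lemma continuous_on_matrix_vector_mult [continuous_intros]: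
  fixes F :: "'a::topological_space \<Rightarrow> 'b::real_normed_field^'k^'l" and g :: "'a \<Rightarrow> 'b::real_normed_field^'k"
  assumes "continuous_on S F" "continuous_on S g"
  shows "continuous_on S (\<lambda>x. F x *v g x)"
  unfolding matrix_vector_mult_def by (intro continuous_intros assms)

lemma continuous_on_det [continuous_intros]:
  fixes F :: "'a::topological_space \<Rightarrow> 'b::real_normed_field^'k^'k"
  assumes "continuous_on S F"
  shows "continuous_on S (\<lambda>x. det (F x))"
  unfolding det_def by (intro continuous_intros assms)

lemma
  assumes "invertible M"
  shows matrix_inv_right: "M ** matrix_inv M = mat 1"
    and matrix_inv_left: "matrix_inv M ** M = mat 1"
proof -
  have "M ** matrix_inv M = mat 1 \<and> matrix_inv M ** M = mat 1"
    using assms unfolding invertible_def matrix_inv_def by (rule someI_ex)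
  then show "M ** matrix_inv M = mat 1" "matrix_inv M ** M = mat 1" by auto
qed

lemma continuous_on_matrix_inv:
  fixes F :: "'a::topological_space \<Rightarrow> 'b::real_normed_field^'k^'k"
  assumes F: "continuous_on S F" and inv: "\<And>x. x \<in> S \<Longrightarrow> invertible (F x)"
  shows "continuous_on S (\<lambda>x. matrix_inv (F x))"
proof -
  have det: "det (F x) \<noteq> 0" if "x \<in> S" for x
    using inv[OF that] by (simp add: invertible_det_nz)
  let ?M = "\<lambda>x k j. \<chi> i l. if l = k then axis j 1 $ i else F x $ i $ l"
  have cramer_inv: "matrix_inv (F x) = (\<chi> k j. det (?M x k j) / det (F x))" if "x \<in> S" for x
  proof -
    have "matrix_inv (F x) $ k $ j = det (?M x k j) / det (F x)" for k j
    proof -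
      have "F x *v column j (matrix_inv (F x)) = axis j 1"
        using matrix_inv_right[OF inv[OF that]]
        by (metis column_matrix_mult matrix_vector_mult_axis matrix_vector_mul_lid)
      then have "column j (matrix_inv (F x)) $ k = det (?M x k j) / det (F x)"
        using cramer[OF det[OF that]] by simp
      then show ?thesis by (simp add: column_def)
    qed
    then show ?thesis by (simp add: vec_eq_iff)
  qed
  have "continuous_on S (\<lambda>x. if l = k then axis j 1 $ i else F x $ i $ l)" for i j k l
    by (cases "l = k") (auto intro!: continuous_intros F)
  then have "continuous_on S (\<lambda>x. \<chi> k j. det (?M x k j) / det (F x))"
    using det by (intro continuous_intros F) auto
  then show ?thesis
    by (subst continuous_on_cong[OF refl cramer_inv]) auto
qed

lemma continuous_on_hermite_vec:
  fixes A :: "'a::topological_space \<Rightarrow> complex^'n^'n" and B :: "'a \<Rightarrow> complex^('m::{finite,linorder})^'n"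
  assumes "continuous_on S A" "continuous_on S B"
  shows "continuous_on S (\<lambda>x. hermite_vec (A x) (B x) c)"
proof -
  have "continuous_on S (\<lambda>x. matpow (A x) k)" for k
    by (induction k) (auto intro!: continuous_intros assms)
  then show ?thesis
    unfolding hermite_vec_def column_def by (intro continuous_intros assms)
qed

section \<open>Reduction to a single input\<close>

theorem lemma3p8:
  fixes P :: "complex set"
    and A :: "complex \<Rightarrow> complex^('n::{finite,linorder})^('n::_)"
    and B :: "complex \<Rightarrow> complex^('m::{finite,linorder})^('n::_)"
  assumes "P \<noteq> {}" and "compact P"
    and "continuous_on P A" and "continuous_on P B"
    and "pointwise_reachable P A B"
    and "constant_hermite_indices P A B"
  shows "\<exists>(K :: complex \<Rightarrow> complex^('n::_)^('m::_)) (v :: complex^('m::_)).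
           continuous_on P K \<and>
           continuous_on P (\<lambda>\<theta>. A \<theta> + B \<theta> ** K \<theta>) \<and>
           continuous_on P (\<lambda>\<theta>. B \<theta> *v v) \<and>
           pointwise_reachable P (\<lambda>\<theta>. A \<theta> + B \<theta> ** K \<theta>)
             (\<lambda>\<theta>. columnvector (B \<theta> *v v) :: complex^1^('n::_))"
proof -
  let ?n = "CARD('n)"
  have reach: "reachable (A \<theta>) (B \<theta>)" if "\<theta> \<in> P" for \<theta>
    using assms(5) that by (simp add: pointwise_reachable_def)
  obtain \<theta>\<^sub>0 where "\<theta>\<^sub>0 \<in> P" using assms(1) by blast
  define C where "C = hermite_sel (A \<theta>\<^sub>0) (B \<theta>\<^sub>0)"
  define r where "r = enumerate C"
  have C: "hermite_sel (A \<theta>) (B \<theta>) = C" if "\<theta> \<in> P" for \<theta>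
  proof -
    have "hermite_index (A \<theta>) (B \<theta>) i = hermite_index (A \<theta>\<^sub>0) (B \<theta>\<^sub>0) i" for i
      using assms(6) that \<open>\<theta>\<^sub>0 \<in> P\<close> unfolding constant_hermite_indices_def by blast
    then show ?thesis unfolding C_def hermite_sel_eq by simp
  qed
  define T where "T \<theta> = (\<chi> i p. hermite_vec (A \<theta>) (B \<theta>) (r (index_pos p)) $ i :: complex^('n::_)^('n::_))" for \<theta>
  define U where "U = (\<chi> j p. block_switch ?n C (index_pos p) $ j :: complex^('n::_)^('m::_))"
  define K where "K \<theta> = U ** matrix_inv (T \<theta>)" for \<theta>
  define v where "v = (axis (index_at (r 0 div ?n)) 1 :: complex^('m::_))"
  have colT: "column p (T \<theta>) = hermite_vec (A \<theta>) (B \<theta>) (r (index_pos p))" for \<theta> p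
    by (simp add: T_def column_def vec_eq_iff)
  have colU: "column p U = block_switch ?n C (index_pos p)" for p
    by (simp add: U_def column_def vec_eq_iff)
  have invT: "invertible (T \<theta>)" if \<theta>: "\<theta> \<in> P" for \<theta>
  proof -
    have "hermite_vec (A \<theta>) (B \<theta>) ` C \<subseteq> columns (T \<theta>)"
    proof clarify
      fix c assume "c \<in> C"
      then obtain p where "p < card C" "r p = c"
        using enumerate_finite_surj[of C c] unfolding r_def C_def by auto
      then have "hermite_vec (A \<theta>) (B \<theta>) c = column (index_at p) (T \<theta>)"
        using card_hermite_sel[OF reach[OF \<theta>]] C[OF \<theta>] by (simp add: colT)
      then show "hermite_vec (A \<theta>) (B \<theta>) c \<in> columns (T \<theta>)"
        by (auto simp: columns_def)
    qed
    then have "vec.span (columns (T \<theta>)) = UNIV"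
      using vec.span_mono span_hermite_sel[OF reach[OF \<theta>]] C[OF \<theta>] by blast
    then show ?thesis
      by (simp add: invertible_right_inverse matrix_right_invertible_span_columns)
  qed
  have contT: "continuous_on P T"
    unfolding T_def by (intro continuous_intros continuous_on_hermite_vec assms)
  have contK: "continuous_on P K"
    unfolding K_def by (intro continuous_intros continuous_on_matrix_inv contT invT)
  have "reachable (A \<theta> + B \<theta> ** K \<theta>) (columnvector (B \<theta> *v v) :: complex^1^('n::_))" if \<theta>: "\<theta> \<in> P" for \<theta>
  proof -
    \<comment> \<open>\<open>K \<theta> ** T \<theta> = U\<close> says column by column that \<open>K \<theta>\<close> takes the prescribed values on the basis.\<close>
    have "K \<theta> *v hermite_vec (A \<theta>) (B \<theta>) (r p) = block_switch ?n C p" if "p < ?n" for p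
    proof -
      have "K \<theta> ** T \<theta> = U"
        unfolding K_def by (simp add: matrix_mul_assoc[symmetric] matrix_inv_left[OF invT[OF \<theta>]])
      then have "K \<theta> *v column (index_at p) (T \<theta>) = column (index_at p) U"
        by (simp flip: column_matrix_mult)
      then show ?thesis using that by (simp add: colT colU)
    qed
    then show ?thesis
      using reachable_block_switch_feedback[OF reach[OF \<theta>], of "K \<theta>"]
      unfolding C[OF \<theta>] v_def r_def by simp
  qed
  then have "pointwise_reachable P (\<lambda>\<theta>. A \<theta> + B \<theta> ** K \<theta>)
      (\<lambda>\<theta>. columnvector (B \<theta> *v v) :: complex^1^('n::_))"
    by (simp add: pointwise_reachable_def)
  moreover have "continuous_on P (\<lambda>\<theta>. A \<theta> + B \<theta> ** K \<theta>)" "continuous_on P (\<lambda>\<theta>. B \<theta> *v v)"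
    by (intro continuous_intros assms contK)+
  ultimately show ?thesis using contK by blast
qed

end
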